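(* Let $n,k,t$ be integers with $1\le t\le k\le n$ and let $D$ be a nonempty set of $k$-subsets of $\{1,\ldots,n\}$. Then $(\{1,\ldots,n\},D)$ is a $t$-$(n,k,\lambda)$ design for some $\lambda$ if and only if $$\binom{n}{i}\sum_{\substack{w\in \mathrm{GF}(2)^n\\ \mathrm{wt}(w)=i}}\hat 1_D(w)^2=\left(\sum_{y\in D}P_i(\mathrm{wt}(y))\right)^2\quad\text{for all } i\in\{1,2,\ldots,t\}.$$
   Context: Vectors in $\mathrm{GF}(2)^n$ are identified with their supports $\{i:x_i=1\}$, so $D$ is also viewed as a set of vectors in $\mathrm{GF}(2)^n$ of Hamming weight $k$; $\mathrm{wt}$ is the Hamming weight. $(\{1,\ldots,n\},D)$ is a $t$-$(n,k,\lambda)$ design if every $t$-subset of $\{1,\ldots,n\}$ is contained in exactly $\lambda$ elements of $D$. $1_D:\mathrm{GF}(2)^n\to\{0,1\}\subset\mathbb{R}$ is the indicator function of $D$, and $\hat 1_D(w)=\sum_{x\in \mathrm{GF}(2)^n}1_D(x)(-1)^{w\cdot x}$ with $w\cdot x=\sum_iw_ix_i$. The Krawtchouk polynomial is $P_i(x)=\sum_{j=0}^{i}(-1)^j\binom{x}{j}\binom{n-x}{i-j}$. *)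

theory Defs
  imports Complex_Main "HOL-Library.FuncSet" "HOL-Library.Z2" "HOL-Library.Indicator_Function"
begin

definition is_design :: "nat \<Rightarrow> nat \<Rightarrow> nat \<Rightarrow> nat \<Rightarrow> nat set set \<Rightarrow> bool" where
  "is_design t n k l D \<longleftrightarrow>
     (\<forall>B\<in>D. B \<subseteq> {1..n} \<and> card B = k) \<and>
     (\<forall>T. T \<subseteq> {1..n} \<and> card T = t \<longrightarrow> card {B \<in> D. T \<subseteq> B} = l)"

text \<open>
  The type \<^typ>\<open>bit\<close> is the field with two elements. Vectors of length \<open>n\<close> are functions on
  \<open>{1..n}\<close>, made extensional so that each vector is represented exactly once.
\<close>

definition gf2_space :: "nat \<Rightarrow> (nat \<Rightarrow> bit) set" where
  "gf2_space n = {1..n} \<rightarrow>\<^sub>E UNIV"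

definition supp :: "nat \<Rightarrow> (nat \<Rightarrow> bit) \<Rightarrow> nat set" where
  "supp n x = {i \<in> {1..n}. x i = 1}"

definition wt :: "nat \<Rightarrow> (nat \<Rightarrow> bit) \<Rightarrow> nat" where
  "wt n x = card (supp n x)"

definition dot :: "nat \<Rightarrow> (nat \<Rightarrow> bit) \<Rightarrow> (nat \<Rightarrow> bit) \<Rightarrow> bit" where
  "dot n w x = (\<Sum>i = 1..n. w i * x i)"

definition vecs :: "nat \<Rightarrow> nat set set \<Rightarrow> (nat \<Rightarrow> bit) set" where
  "vecs n D = {x \<in> gf2_space n. supp n x \<in> D}"

definition fourier :: "nat \<Rightarrow> ((nat \<Rightarrow> bit) \<Rightarrow> real) \<Rightarrow> (nat \<Rightarrow> bit) \<Rightarrow> real" where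
  "fourier n f w = (\<Sum>x\<in>gf2_space n. f x * (-1) ^ of_bit (dot n w x))"

definition krawtchouk :: "nat \<Rightarrow> nat \<Rightarrow> real \<Rightarrow> real" where
  "krawtchouk n i x =
     (\<Sum>j = 0..i. (-1) ^ j * (x gchoose j) * ((real n - x) gchoose (i - j)))"

text \<open>
  Taking supports identifies vectors with subsets of \<open>{1..n}\<close>, so \<^const>\<open>vecs\<close> loses nothing.
\<close>

lemma bij_betw_supp: "bij_betw (supp n) (gf2_space n) (Pow {1..n})"
proof (rule bij_betwI[where g = "\<lambda>S. \<lambda>i\<in>{1..n}. of_bool (i \<in> S)"])
  show "supp n \<in> gf2_space n \<rightarrow> Pow {1..n}"
    by (auto simp: supp_def)
  show "(\<lambda>S. \<lambda>i\<in>{1..n}. of_bool (i \<in> S)) \<in> Pow {1..n} \<rightarrow> gf2_space n"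
    by (auto simp: gf2_space_def)
next
  fix x assume x: "x \<in> gf2_space n"
  show "(\<lambda>i\<in>{1..n}. of_bool (i \<in> supp n x)) = x"
  proof
    fix i
    show "(\<lambda>i\<in>{1..n}. of_bool (i \<in> supp n x)) i = x i"
      using x by (cases "x i") (auto simp: gf2_space_def supp_def PiE_def extensional_def)
  qed
next
  fix S assume "S \<in> Pow {1..n}"
  then show "supp n (\<lambda>i\<in>{1..n}. of_bool (i \<in> S)) = S"
    by (auto simp: supp_def)
qed

lemma bij_betw_vecs:
  assumes "D \<subseteq> Pow {1..n}"
  shows "bij_betw (supp n) (vecs n D) D"
  unfolding bij_betw_def
proof
  show "inj_on (supp n) (vecs n D)"
    using bij_betw_supp[of n] by (rule inj_on_subset[OF bij_betw_imp_inj_on]) (auto simp: vecs_def)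
  show "supp n ` vecs n D = D"
  proof (intro equalityI subsetI)
    fix B assume "B \<in> D"
    then obtain x where "x \<in> gf2_space n" "supp n x = B"
      using assms bij_betw_supp[of n] by (metis bij_betw_imp_surj_on imageE subsetD)
    with \<open>B \<in> D\<close> show "B \<in> supp n ` vecs n D"
      by (auto simp: vecs_def)
  qed (auto simp: vecs_def)
qed

end

theory Submission
  imports Defs
begin

text \<open>
  Write \<open>c(W) = (\<Sum>B\<in>D. (-1)\<^bsup>|W \<inter> B|\<^esup>)\<close> for the Fourier transform of \<open>1\<^sub>D\<close>, read as a function
  of supports. Summing the character \<open>W \<mapsto> (-1)\<^bsup>|W \<inter> B|\<^esup>\<close> over the \<open>i\<close>-subsets \<open>W\<close> of
  \<open>{1..n}\<close> gives \<open>P\<^sub>i(|B|)\<close> (\<open>sum_character_layer\<close>), so the right-hand side of the \<open>i\<close>-th identity is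
  the square of the sum of \<open>c\<close> over the layer of \<open>i\<close>-subsets, while the left-hand side is the size of
  that layer times the sum of the squares of \<open>c\<close>. The identity is therefore the equality case of the
  Cauchy--Schwarz inequality, and says precisely that \<open>c\<close> is constant on the \<open>i\<close>-th layer
  (\<open>Cauchy_Schwarz_equality_iff_constant\<close>).

  It remains to relate the constancy of \<open>c\<close> on low layers to the design property. Let \<open>m(T)\<close> be the
  number of blocks that contain \<open>T\<close>. Expanding each sign as \<open>\<Prod>\<^bsub>i\<in>W\<^esub> (1 - 2 [i \<in> B])\<close> gives
  \<open>c(W) = \<Sum>\<^bsub>T\<subseteq>W\<^esub> (-2)\<^bsup>|T|\<^esup> m(T)\<close> (\<open>character_sum_eq_sum_degrees\<close>). This relation is
  triangular, with nonzero coefficients that depend on \<open>|T|\<close> only, so \<open>c\<close> is constant on each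
  of the layers \<open>0, \<dots>, t\<close> if and only if \<open>m\<close> is (\<open>subset_sums_constant_on_layers_iff\<close>). Finally, the
  constancy of \<open>m\<close> on layer \<open>t\<close>, which is the design property, propagates down to all smaller layers
  by double counting, because all blocks have the same size \<open>k \<ge> t\<close>
  (\<open>degree_constant_on_lower_layers\<close>).
\<close>

section \<open>Functions that are constant on layers of the subset lattice\<close>

definition constant_on_layer :: "'a set \<Rightarrow> nat \<Rightarrow> ('a set \<Rightarrow> 'b) \<Rightarrow> bool" where
  "constant_on_layer N i f \<longleftrightarrow> (\<exists>c. \<forall>S. S \<subseteq> N \<and> card S = i \<longrightarrow> f S = c)"

lemma constant_on_layerI:
  assumes "\<And>S T. S \<subseteq> N \<Longrightarrow> T \<subseteq> N \<Longrightarrow> card S = i \<Longrightarrow> card T = i \<Longrightarrow> f S = f T"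
  shows "constant_on_layer N i f"
proof (cases "\<exists>S. S \<subseteq> N \<and> card S = i")
  case True
  then obtain S where "S \<subseteq> N" "card S = i"
    by blast
  then have "\<forall>T. T \<subseteq> N \<and> card T = i \<longrightarrow> f T = f S"
    using assms by blast
  then show ?thesis
    unfolding constant_on_layer_def by (rule exI)
qed (auto simp: constant_on_layer_def)

lemma constant_on_layerD:
  assumes "constant_on_layer N i f" "S \<subseteq> N" "T \<subseteq> N" "card S = i" "card T = i"
  shows "f S = f T"
proof -
  obtain c where c: "\<forall>U. U \<subseteq> N \<and> card U = i \<longrightarrow> f U = c"
    using assms(1) unfolding constant_on_layer_def by (rule exE)
  have "f S = c" "f T = c"
    using assms(2-5) by (simp_all add: c)
  then show ?thesis by simp
qed

lemma constant_on_layer_zero: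
  assumes "finite N"
  shows "constant_on_layer N 0 f"
proof (rule constant_on_layerI)
  fix S T assume "S \<subseteq> N" "T \<subseteq> N" "card S = 0" "card T = 0"
  moreover from this have "finite S" "finite T"
    using assms by (auto dest: finite_subset)
  ultimately show "f S = f T"
    by simp
qed

lemma constant_on_layer_of_nat_iff:
  "constant_on_layer N i (\<lambda>T. of_nat (f T) :: 'b::semiring_char_0) \<longleftrightarrow> constant_on_layer N i f"
proof
  assume of_nat: "constant_on_layer N i (\<lambda>T. of_nat (f T) :: 'b)"
  show "constant_on_layer N i f"
  proof (rule constant_on_layerI)
    fix S T assume "S \<subseteq> N" "T \<subseteq> N" "card S = i" "card T = i"
    then have "(of_nat (f S) :: 'b) = of_nat (f T)"
      by (rule constant_on_layerD[OF of_nat])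
    then show "f S = f T" by simp
  qed
qed (auto simp: constant_on_layer_def)

text \<open>A bijection between two sets of equal size induces one between their power sets, and that
  bijection preserves cardinality.\<close>

lemma sum_card_Pow_cong:
  assumes "finite V" and "finite W" and "card V = card W"
  shows "(\<Sum>T\<in>Pow V. g (card T)) = (\<Sum>T\<in>Pow W. g (card T))"
proof -
  obtain h where h: "bij_betw h V W"
    using finite_same_card_bij assms by blast
  have "(\<Sum>T\<in>Pow W. g (card T)) = (\<Sum>T\<in>Pow V. g (card (h ` T)))"
    using sum.reindex_bij_betw[OF bij_betw_Pow[OF h], of "\<lambda>T. g (card T)"] by simp
  also have "\<dots> = (\<Sum>T\<in>Pow V. g (card T))"
    using h by (intro sum.cong refl arg_cong[of _ _ g] card_image)
      (auto simp: bij_betw_def intro: inj_on_subset)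
  finally show ?thesis by simp
qed

text \<open>The function \<open>f\<close> arises from \<open>m\<close> by a triangular transformation of the subset lattice. The
  diagonal entry \<open>a |W|\<close> is invertible, so \<open>m W\<close> can be recovered from \<open>f W\<close> and the values of \<open>m\<close> on
  proper subsets, whose total contribution depends on \<open>|W|\<close> only once the lower layers are known to be
  constant.\<close>

lemma subset_sums_constant_on_layers_iff:
  fixes m f :: "'a set \<Rightarrow> real"
  assumes "finite N" and a: "\<And>j. a j \<noteq> 0"
    and f: "\<And>W. W \<subseteq> N \<Longrightarrow> f W = (\<Sum>T\<in>Pow W. a (card T) * m T)"
  shows "(\<forall>i\<le>t. constant_on_layer N i f) \<longleftrightarrow> (\<forall>i\<le>t. constant_on_layer N i m)"
proof
  assume m: "\<forall>i\<le>t. constant_on_layer N i m"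
  then obtain \<mu> where \<mu>: "\<And>T. T \<subseteq> N \<Longrightarrow> card T \<le> t \<Longrightarrow> m T = \<mu> (card T)"
    unfolding constant_on_layer_def by metis
  have expand: "f W = (\<Sum>T\<in>Pow W. a (card T) * \<mu> (card T))"
    if W: "W \<subseteq> N" "card W \<le> t" "finite W" for W
  proof -
    have "m T = \<mu> (card T)" if "T \<in> Pow W" for T
      using W card_mono[OF \<open>finite W\<close>, of T] that by (intro \<mu>) auto
    then show ?thesis
      using f[OF \<open>W \<subseteq> N\<close>] by simp
  qed
  show "\<forall>i\<le>t. constant_on_layer N i f"
  proof (intro allI impI constant_on_layerI)
    fix i V W assume *: "i \<le> t" "V \<subseteq> N" "W \<subseteq> N" "card V = i" "card W = i"
    then have "finite V" "finite W"
      using \<open>finite N\<close> by (auto dest: finite_subset)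
    then show "f V = f W"
      using * expand[of V] expand[of W] sum_card_Pow_cong[of V W "\<lambda>j. a j * \<mu> j"] by simp
  qed
next
  assume fc: "\<forall>i\<le>t. constant_on_layer N i f"
  have "i \<le> t \<Longrightarrow> constant_on_layer N i m" for i
  proof (induction i rule: less_induct)
    case (less i)
    then have "\<forall>j<i. constant_on_layer N j m"
      by simp
    then obtain \<mu> where \<mu>: "\<And>T. T \<subseteq> N \<Longrightarrow> card T < i \<Longrightarrow> m T = \<mu> (card T)"
      unfolding constant_on_layer_def by metis
    have expand: "f W = a i * m W + ((\<Sum>T\<in>Pow W. a (card T) * \<mu> (card T)) - a i * \<mu> i)"
      if W: "W \<subseteq> N" "card W = i" "finite W" for W
    proof -
      have "f W = a i * m W + (\<Sum>T\<in>Pow W - {W}. a (card T) * m T)"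
        using W f[OF W(1)] sum.remove[of "Pow W" W "\<lambda>T. a (card T) * m T"] by simp
      also have "(\<Sum>T\<in>Pow W - {W}. a (card T) * m T) =
                 (\<Sum>T\<in>Pow W - {W}. a (card T) * \<mu> (card T))"
      proof (intro sum.cong refl)
        fix T assume T: "T \<in> Pow W - {W}"
        then have "card T < i"
          using W psubset_card_mono[of W T] by auto
        then show "a (card T) * m T = a (card T) * \<mu> (card T)"
          using \<mu>[of T] T W by auto
      qed
      also have "\<dots> = (\<Sum>T\<in>Pow W. a (card T) * \<mu> (card T)) - a i * \<mu> i"
        using W by (simp add: sum_diff1)
      finally show ?thesis .
    qed
    show ?case
    proof (rule constant_on_layerI)
      fix V W assume *: "V \<subseteq> N" "W \<subseteq> N" "card V = i" "card W = i"
      then have fin: "finite V" "finite W"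
        using \<open>finite N\<close> by (auto dest: finite_subset)
      have "f V = f W"
        using fc less.prems * by (blast intro: constant_on_layerD)
      then have "a i * m V = a i * m W"
        using expand[of V] expand[of W] * fin
          sum_card_Pow_cong[of V W "\<lambda>j. a j * \<mu> j"] by simp
      then show "m V = m W"
        using a[of i] by simp
    qed
  qed
  then show "\<forall>i\<le>t. constant_on_layer N i m" by blast
qed

section \<open>Block degrees and character sums\<close>

definition degree :: "'a set set \<Rightarrow> 'a set \<Rightarrow> nat" where
  "degree D T = card {B \<in> D. T \<subseteq> B}"

definition character_sum :: "'a set set \<Rightarrow> 'a set \<Rightarrow> real" where
  "character_sum D W = (\<Sum>B\<in>D. (-1) ^ card (W \<inter> B))"

text \<open>The sign \<open>(-1)\<^bsup>|X|\<^esup>\<close> is the product of \<open>|X|\<close> factors \<open>-2 + 1\<close>; expanding that product for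
  \<open>X = W \<inter> B\<close> and exchanging the two summations counts, for each \<open>T\<close>, the blocks above it.\<close>

lemma character_sum_eq_sum_degrees:
  assumes "finite D" and "finite W"
  shows "character_sum D W = (\<Sum>T\<in>Pow W. (-2) ^ card T * real (degree D T))"
proof -
  have sign: "(-1) ^ card (W \<inter> B) = (\<Sum>T\<in>Pow W. (-2) ^ card T * of_bool (T \<subseteq> B) :: real)" for B
  proof -
    have "(-1 :: real) ^ card (W \<inter> B) = (\<Prod>x\<in>W \<inter> B. -2 + 1)"
      by simp
    also have "\<dots> = (\<Sum>T\<in>Pow (W \<inter> B). (-2) ^ card T)"
      using assms by (subst prod_add) auto
    also have "\<dots> = (\<Sum>T\<in>Pow W. (-2) ^ card T * of_bool (T \<subseteq> B))"
      using assms by (intro sum.mono_neutral_cong_left) auto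
    finally show ?thesis .
  qed
  have count: "(\<Sum>B\<in>D. of_bool (T \<subseteq> B)) = real (degree D T)" for T
    using assms by (simp add: degree_def of_bool_def sum.If_cases Int_def)
  have "character_sum D W = (\<Sum>T\<in>Pow W. \<Sum>B\<in>D. (-2) ^ card T * of_bool (T \<subseteq> B))"
    unfolding character_sum_def sign by (rule sum.swap)
  also have "\<dots> = (\<Sum>T\<in>Pow W. (-2) ^ card T * real (degree D T))"
    by (simp only: sum_distrib_left[symmetric] count)
  finally show ?thesis .
qed

text \<open>Both sides count the pairs of a block above \<open>I\<close> and a point of that block outside \<open>I\<close>.\<close>

lemma sum_degree_insert:
  assumes "finite N" and D: "\<And>B. B \<in> D \<Longrightarrow> B \<subseteq> N \<and> card B = k"
  shows "(\<Sum>x\<in>N - I. degree D (insert x I)) = (k - card I) * degree D I"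
proof -
  have "finite D"
    using D \<open>finite N\<close> by (intro finite_subset[of D "Pow N"]) auto
  have fib: "card {x \<in> N - I. x \<in> B} = k - card I" if "B \<in> D" "I \<subseteq> B" for B
  proof -
    have "{x \<in> N - I. x \<in> B} = B - I"
      using D that by auto
    moreover have "finite I"
      using D \<open>finite N\<close> that finite_subset by metis
    ultimately show ?thesis
      using D that by (simp add: card_Diff_subset)
  qed
  have "(\<Sum>x\<in>N - I. degree D (insert x I)) =
        (\<Sum>x\<in>N - I. card {B \<in> {B \<in> D. I \<subseteq> B}. x \<in> B})"
    unfolding degree_def by (intro sum.cong refl arg_cong[of _ _ card]) auto
  also have "\<dots> = (k - card I) * card {B \<in> D. I \<subseteq> B}"
    using \<open>finite N\<close> \<open>finite D\<close> fib by (intro sum_multicount) auto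
  finally show ?thesis
    by (simp add: degree_def)
qed

text \<open>Dividing the double count by \<open>k - i > 0\<close> expresses the degree of an \<open>i\<close>-set through the degrees
  of \<open>n - i\<close> sets in the next layer.\<close>

lemma degree_constant_on_lower_layers:
  assumes "finite N" and D: "\<And>B. B \<in> D \<Longrightarrow> B \<subseteq> N \<and> card B = k"
    and "constant_on_layer N t (degree D)" and "t \<le> k" and "i \<le> t"
  shows "constant_on_layer N i (degree D)"
  using \<open>i \<le> t\<close>
proof (induction i rule: inc_induct)
  case base
  show ?case by fact
next
  case (step i)
  show ?case
  proof (rule constant_on_layerI)
    fix S T assume *: "S \<subseteq> N" "T \<subseteq> N" "card S = i" "card T = i"
    then have fin: "finite S" "finite T"
      using \<open>finite N\<close> by (auto dest: finite_subset)
    have same: "degree D (insert x S) = degree D (insert y T)" if "x \<in> N - S" "y \<in> N - T" for x y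
      using that * fin by (intro constant_on_layerD[OF step.IH]) auto
    have card_eq: "card (N - S) = card (N - T)"
      using * fin by (simp add: card_Diff_subset)
    obtain h where h: "bij_betw h (N - S) (N - T)"
      using finite_same_card_bij card_eq \<open>finite N\<close> by blast
    have "(\<Sum>x\<in>N - S. degree D (insert x S)) = (\<Sum>x\<in>N - S. degree D (insert (h x) T))"
      using h by (intro sum.cong refl same) (auto simp: bij_betw_def)
    also have "\<dots> = (\<Sum>y\<in>N - T. degree D (insert y T))"
      by (rule sum.reindex_bij_betw[OF h])
    finally have "(k - i) * degree D S = (k - i) * degree D T"
      using * sum_degree_insert[OF assms(1) D, where I = S]
        sum_degree_insert[OF assms(1) D, where I = T] by simp
    then show "degree D S = degree D T"
      using step.hyps \<open>t \<le> k\<close> by simp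
  qed
qed

lemma is_design_iff_constant_degree:
  assumes "\<forall>B\<in>D. B \<subseteq> {1..n} \<and> card B = k"
  shows "(\<exists>l. is_design t n k l D) \<longleftrightarrow> constant_on_layer {1..n} t (degree D)"
  using assms by (auto simp: is_design_def constant_on_layer_def degree_def)

section \<open>The equality case of the Cauchy--Schwarz inequality\<close>

text \<open>With \<open>\<mu>\<close> the mean of \<open>f\<close> over \<open>A\<close>, the difference of the two sides is
  \<open>|A| (\<Sum>x\<in>A. (f x - \<mu>)\<^sup>2)\<close>, which vanishes only when every term does.\<close>

lemma Cauchy_Schwarz_equality_iff_constant:
  fixes f :: "'a \<Rightarrow> real"
  assumes "finite A"
  shows "real (card A) * (\<Sum>x\<in>A. (f x)\<^sup>2) = (\<Sum>x\<in>A. f x)\<^sup>2 \<longleftrightarrow> (\<exists>c. \<forall>x\<in>A. f x = c)"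
    (is "?CS \<longleftrightarrow> ?const")
proof (cases "A = {}")
  case False
  define \<mu> where "\<mu> = (\<Sum>x\<in>A. f x) / real (card A)"
  have pos: "real (card A) > 0"
    using False assms by (simp add: card_gt_0_iff)
  have sum: "(\<Sum>x\<in>A. f x) = real (card A) * \<mu>"
    using pos by (simp add: \<mu>_def)
  have expand: "(\<Sum>x\<in>A. (f x - \<mu>)\<^sup>2) = (\<Sum>x\<in>A. (f x)\<^sup>2) - 2 * \<mu> * (\<Sum>x\<in>A. f x) + real (card A) * \<mu>\<^sup>2"
    by (simp add: power2_diff sum.distrib sum_subtractf flip: sum_distrib_left sum_distrib_right)
  have dev: "real (card A) * (\<Sum>x\<in>A. (f x - \<mu>)\<^sup>2) =
      real (card A) * (\<Sum>x\<in>A. (f x)\<^sup>2) - (\<Sum>x\<in>A. f x)\<^sup>2"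
    unfolding expand unfolding sum by (simp add: algebra_simps power2_eq_square)
  show ?thesis
  proof
    assume ?CS
    then have "(\<Sum>x\<in>A. (f x - \<mu>)\<^sup>2) = 0"
      using dev pos by simp
    then have "\<forall>x\<in>A. f x = \<mu>"
      using assms by (simp add: sum_nonneg_eq_0_iff)
    then show ?const by blast
  next
    assume ?const
    then obtain c where "\<forall>x\<in>A. f x = c"
      by blast
    then show ?CS
      by (simp add: power2_eq_square)
  qed
qed simp

section \<open>Krawtchouk polynomials as character sums\<close>

text \<open>An \<open>i\<close>-set that meets \<open>B\<close> in \<open>j\<close> points consists of a \<open>j\<close>-subset of \<open>B\<close> and an
  \<open>(i - j)\<close>-subset of the complement, chosen independently.\<close>

lemma card_layer_with_intersection:
  assumes "finite N" and "B \<subseteq> N" and "j \<le> i"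
  shows "card {W. W \<subseteq> N \<and> card W = i \<and> card (W \<inter> B) = j} =
         (card B choose j) * ((card N - card B) choose (i - j))"
proof -
  let ?X = "{X. X \<subseteq> B \<and> card X = j}" and ?Y = "{Y. Y \<subseteq> N - B \<and> card Y = i - j}"
  let ?W = "{W. W \<subseteq> N \<and> card W = i \<and> card (W \<inter> B) = j}"
  have finB: "finite B"
    using assms finite_subset by blast
  have "bij_betw (\<lambda>W. (W \<inter> B, W - B)) ?W (?X \<times> ?Y)"
  proof (rule bij_betwI[where g = "\<lambda>(X, Y). X \<union> Y"])
    show "(\<lambda>W. (W \<inter> B, W - B)) \<in> ?W \<rightarrow> ?X \<times> ?Y"
    proof
      fix W assume W: "W \<in> ?W"
      then have "finite W"
        using assms finite_subset by blast
      then show "(W \<inter> B, W - B) \<in> ?X \<times> ?Y"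
        using W by (auto simp: card_Diff_subset_Int)
    qed
    show "(\<lambda>(X, Y). X \<union> Y) \<in> ?X \<times> ?Y \<rightarrow> ?W"
    proof
      fix p assume "p \<in> ?X \<times> ?Y"
      then obtain X Y where p: "p = (X, Y)"
        and X: "X \<subseteq> B" "card X = j" and Y: "Y \<subseteq> N - B" "card Y = i - j"
        by auto
      have "finite X" "finite Y"
        using X Y assms finB by (auto dest: finite_subset)
      moreover have "X \<inter> Y = {}" "(X \<union> Y) \<inter> B = X"
        using X Y by auto
      ultimately show "(case p of (X, Y) \<Rightarrow> X \<union> Y) \<in> ?W"
        using X Y p assms by (auto simp: card_Un_disjoint)
    qed
  qed auto
  then have "card ?W = card (?X \<times> ?Y)"
    by (rule bij_betw_same_card)
  also have "\<dots> = (card B choose j) * (card (N - B) choose (i - j))"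
    using assms finB by (simp add: card_cartesian_product n_subsets)
  finally show ?thesis
    using assms finB by (simp add: card_Diff_subset)
qed

lemma sum_character_layer:
  assumes "B \<subseteq> {1..n}"
  shows "(\<Sum>W | W \<subseteq> {1..n} \<and> card W = i. (-1) ^ card (W \<inter> B)) = krawtchouk n i (real (card B))"
proof -
  let ?L = "{W. W \<subseteq> {1..n} \<and> card W = i}"
  have le: "card B \<le> n"
    using card_mono[OF _ assms] by simp
  have bound: "card (W \<inter> B) \<in> {0..i}" if "W \<in> ?L" for W
  proof -
    have "finite W"
      using that finite_subset by blast
    then show ?thesis
      using that card_mono[of W "W \<inter> B"] by auto
  qed
  have "(\<Sum>W\<in>?L. (-1 :: real) ^ card (W \<inter> B)) =
        (\<Sum>j\<in>{0..i}. \<Sum>W\<in>{W \<in> ?L. card (W \<inter> B) = j}. (-1) ^ card (W \<inter> B))"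
    using bound by (intro sum.group[symmetric]) auto
  also have "\<dots> = (\<Sum>j = 0..i. (-1) ^ j * real ((card B choose j) * ((n - card B) choose (i - j))))"
  proof (intro sum.cong refl)
    fix j assume "j \<in> {0..i}"
    have "(\<Sum>W\<in>{W \<in> ?L. card (W \<inter> B) = j}. (-1 :: real) ^ card (W \<inter> B)) =
          (-1) ^ j * real (card {W. W \<subseteq> {1..n} \<and> card W = i \<and> card (W \<inter> B) = j})"
      by (simp add: conj_assoc)
    also have "\<dots> = (-1) ^ j * real ((card B choose j) * ((n - card B) choose (i - j)))"
      using card_layer_with_intersection[OF _ assms, of j i] \<open>j \<in> {0..i}\<close> by simp
    finally show "(\<Sum>W\<in>{W \<in> ?L. card (W \<inter> B) = j}. (-1 :: real) ^ card (W \<inter> B)) =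
      (-1) ^ j * real ((card B choose j) * ((n - card B) choose (i - j)))" .
  qed
  also have "\<dots> = krawtchouk n i (real (card B))"
    using le by (simp add: krawtchouk_def binomial_gbinomial of_nat_diff mult.assoc)
  finally show ?thesis .
qed

section \<open>From vectors to supports\<close>

lemma dot_eq_card_supp: "dot n w x = of_nat (card (supp n w \<inter> supp n x))"
proof -
  have "dot n w x = (\<Sum>i\<in>{1..n}. if i \<in> supp n w \<inter> supp n x then 1 else 0)"
    unfolding dot_def by (intro sum.cong refl) (auto simp: supp_def)
  also have "\<dots> = (\<Sum>i\<in>{1..n} \<inter> (supp n w \<inter> supp n x). 1)"
    by (rule sum.inter_restrict[symmetric]) simp
  also have "{1..n} \<inter> (supp n w \<inter> supp n x) = supp n w \<inter> supp n x"
    by (auto simp: supp_def)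
  finally show ?thesis
    by simp
qed

lemma sign_of_bit_of_nat: "(-1 :: real) ^ of_bit (of_nat m :: bit) = (-1) ^ m"
  by (simp only: even_of_nat minus_one_power_iff) simp

lemma fourier_indicator_vecs:
  assumes "D \<subseteq> Pow {1..n}"
  shows "fourier n (indicator (vecs n D)) w = character_sum D (supp n w)"
proof -
  have fin: "finite (gf2_space n)"
    using bij_betw_finite[OF bij_betw_supp[of n]] by simp
  have "fourier n (indicator (vecs n D)) w = (\<Sum>x\<in>vecs n D. (-1) ^ of_bit (dot n w x))"
    unfolding fourier_def using fin
    by (intro sum.mono_neutral_cong_right) (auto simp: vecs_def indicator_def)
  also have "\<dots> = (\<Sum>x\<in>vecs n D. (-1) ^ card (supp n w \<inter> supp n x))"
    by (intro sum.cong refl) (simp only: dot_eq_card_supp sign_of_bit_of_nat)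
  also have "\<dots> = character_sum D (supp n w)"
    unfolding character_sum_def by (rule sum.reindex_bij_betw[OF bij_betw_vecs[OF assms]])
  finally show ?thesis .
qed

lemma bij_betw_supp_layer:
  "bij_betw (supp n) {w. w \<in> gf2_space n \<and> wt n w = i} {W. W \<subseteq> {1..n} \<and> card W = i}"
proof -
  have "supp n ` {w. w \<in> gf2_space n \<and> wt n w = i} = {W \<in> supp n ` gf2_space n. card W = i}"
    unfolding wt_def by blast
  then have "supp n ` {w. w \<in> gf2_space n \<and> wt n w = i} = {W. W \<subseteq> {1..n} \<and> card W = i}"
    by (simp only: bij_betw_imp_surj_on[OF bij_betw_supp] Pow_iff)
  moreover have "inj_on (supp n) {w. w \<in> gf2_space n \<and> wt n w = i}"
    by (rule inj_on_subset[OF bij_betw_imp_inj_on[OF bij_betw_supp[of n]]]) auto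
  ultimately show ?thesis
    by (simp add: bij_betw_def)
qed

section \<open>Characterisation of designs\<close>

lemma layer_identity_iff:
  assumes "D \<subseteq> Pow {1..n}"
  shows "real (n choose i) *
      (\<Sum>w | w \<in> gf2_space n \<and> wt n w = i. (fourier n (indicator (vecs n D)) w)\<^sup>2) =
      (\<Sum>y\<in>vecs n D. krawtchouk n i (real (wt n y)))\<^sup>2
    \<longleftrightarrow> constant_on_layer {1..n} i (character_sum D)"
proof -
  let ?L = "{W. W \<subseteq> {1..n} \<and> card W = i}"
  have squares: "(\<Sum>w | w \<in> gf2_space n \<and> wt n w = i. (fourier n (indicator (vecs n D)) w)\<^sup>2) =
      (\<Sum>W\<in>?L. (character_sum D W)\<^sup>2)"
    using sum.reindex_bij_betw[OF bij_betw_supp_layer, of "\<lambda>W. (character_sum D W)\<^sup>2"]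
    by (simp add: fourier_indicator_vecs[OF assms])
  have "(\<Sum>y\<in>vecs n D. krawtchouk n i (real (wt n y))) = (\<Sum>B\<in>D. krawtchouk n i (real (card B)))"
    unfolding wt_def by (rule sum.reindex_bij_betw[OF bij_betw_vecs[OF assms]])
  also have "\<dots> = (\<Sum>B\<in>D. \<Sum>W\<in>?L. (-1) ^ card (W \<inter> B))"
    using assms by (intro sum.cong refl sum_character_layer[symmetric]) auto
  also have "\<dots> = (\<Sum>W\<in>?L. character_sum D W)"
    unfolding character_sum_def by (rule sum.swap)
  finally have linear: "(\<Sum>y\<in>vecs n D. krawtchouk n i (real (wt n y))) = (\<Sum>W\<in>?L. character_sum D W)" .
  have "card ?L = n choose i"
    using n_subsets[of "{1..n}" i] by simp
  then show ?thesis
    using Cauchy_Schwarz_equality_iff_constant[of ?L "character_sum D"]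
    unfolding squares linear constant_on_layer_def by auto
qed

theorem corollary45:
  fixes n k t :: nat and D :: "nat set set"
  assumes "1 \<le> t" and "t \<le> k" and "k \<le> n"
    and "D \<noteq> {}"
    and "\<forall>B\<in>D. B \<subseteq> {1..n} \<and> card B = k"
  shows "(\<exists>l. is_design t n k l D) \<longleftrightarrow>
    (\<forall>i\<in>{1..t}.
       real (n choose i) *
         (\<Sum>w | w \<in> gf2_space n \<and> wt n w = i. (fourier n (indicator (vecs n D)) w)\<^sup>2) =
       (\<Sum>y\<in>vecs n D. krawtchouk n i (real (wt n y)))\<^sup>2)"
proof -
  have D: "D \<subseteq> Pow {1..n}"
    using assms(5) by auto
  then have "finite D"
    by (rule finite_subset) simp
  have "(\<exists>l. is_design t n k l D) \<longleftrightarrow> constant_on_layer {1..n} t (degree D)"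
    using assms(5) by (rule is_design_iff_constant_degree)
  also have "\<dots> \<longleftrightarrow> (\<forall>i\<le>t. constant_on_layer {1..n} i (degree D))"
    using degree_constant_on_lower_layers[of "{1..n}" D k t] assms(2,5) by auto
  also have "\<dots> \<longleftrightarrow> (\<forall>i\<le>t. constant_on_layer {1..n} i (\<lambda>T. real (degree D T)))"
    by (simp only: constant_on_layer_of_nat_iff)
  also have "\<dots> \<longleftrightarrow> (\<forall>i\<le>t. constant_on_layer {1..n} i (character_sum D))"
  proof (rule subset_sums_constant_on_layers_iff[symmetric])
    fix W assume "W \<subseteq> {1..n}"
    then show "character_sum D W = (\<Sum>T\<in>Pow W. (-2) ^ card T * real (degree D T))"
      using \<open>finite D\<close> finite_subset by (intro character_sum_eq_sum_degrees) auto
  qed auto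
  \<comment> \<open>Layer 0 consists of the empty set alone, so it imposes no condition.\<close>
  also have "\<dots> \<longleftrightarrow> (\<forall>i\<in>{1..t}. constant_on_layer {1..n} i (character_sum D))"
  proof (intro iffI allI ballI impI)
    fix i assume "\<forall>i\<in>{1..t}. constant_on_layer {1..n} i (character_sum D)" and "i \<le> t"
    then show "constant_on_layer {1..n} i (character_sum D)"
      by (cases "i = 0") (auto simp: constant_on_layer_zero)
  qed auto
  finally show ?thesis
    by (simp add: layer_identity_iff[OF D])
qed

end
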